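(* Let $A=\{a_n\}$ and $B=\{b_n\}$ be infinite sets of natural numbers, and let $\vartheta:\mathbb{N}\to\mathbb{R}^+$ be a function such that $\limsup_{n\to\infty}\frac{a_n}{n\cdot\vartheta(n)}<\infty$. (1) If $\lim_{n\to\infty}\frac{\vartheta(b_n)}{n}=0$, then $R_k(A)\cap\Delta(B)$ is infinite for all $k\in\mathbb{N}$. (2) If $\lim_{n\to\infty}\frac{\vartheta(n\cdot b_n)}{n}=0$, then there exists a sequence $\langle x_n\mid n\in\mathbb{N}\rangle$ of elements of $\Delta(B)$ such that $$\limsup_{n\to\infty}\left(\frac{\frac{|A\cap(A+x_n)\cap[1,n]|}{n}}{\left(\frac{|A\cap[1,n]|}{n}\right)^2}\right)\ \ge\ 1.$$
   Context: $\mathbb{N}$ is the set of positive integers and $\mathbb{R}^+$ the set of positive reals. For an infinite set $A\subseteq\mathbb{N}$, writing $A=\{a_n\}$ means that $a_1<a_2<\ldots<a_n<\ldots$ is the increasing enumeration of $A$; similarly $B=\{b_n\}$. $A+x=\{a+x\mid a\in A\}$. The set of distances of $B$ is $\Delta(B)=\{b-b'\mid b,b'\in B,\ b>b'\}$. For $k\in\mathbb{N}$, $R_k(A)=\{x\in\mathbb{N} : |A\cap(A+x)|\ge k\}$. The quotient in (2) is considered for $n\ge a_1$, where its denominator is nonzero. *)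

theory Defs
  imports "HOL-Analysis.Analysis" "HOL-Library.Infinite_Set"
begin

(* Natural numbers are positive here: sets of naturals are assumed to be subsets of {1..},
   and sequences are indexed from 1 (the value at index 0 is junk, irrelevant to limits). *)

(* 1-based increasing enumeration of an infinite set: elt A 1 < elt A 2 < ...
   (the library's enumerate starts at index 0). *)
definition elt :: "nat set \<Rightarrow> nat \<Rightarrow> nat" where
  "elt A n = enumerate A (n - 1)"

definition shift :: "nat set \<Rightarrow> nat \<Rightarrow> nat set" where
  "shift A x = {a + x | a. a \<in> A}"

definition Delta :: "nat set \<Rightarrow> nat set" where
  "Delta B = {b - b' | b b'. b \<in> B \<and> b' \<in> B \<and> b > b'}"

(* The intersection may be infinite, where card returns 0; hence the first disjunct. *)
definition R :: "nat \<Rightarrow> nat set \<Rightarrow> nat set" where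
  "R k A = {x. x \<ge> 1 \<and> (infinite (A \<inter> shift A x) \<or> card (A \<inter> shift A x) \<ge> k)}"

end

theory Submission
  imports Defs
begin

text \<open>
  Both parts rest on one second-moment count. Take the portion \<open>S\<close> of \<open>A\<close> up to its \<open>N\<close>-th element
  \<open>M\<close>, and translate it by \<open>n\<close> elements of \<open>B\<close>, none larger than \<open>b\<close>. The \<open>n\<close> translates have \<open>N\<close>
  points each and all lie in \<open>[1, M + b]\<close>, so by Cauchy-Schwarz the ordered pairs of translates
  share at least \<open>(n N)\<^sup>2 / (M + b)\<close> points in total. The diagonal pairs account for only \<open>n N\<close> of
  these; when \<open>n\<close> is large compared with \<open>M / N\<close>, the off-diagonal pairs carry the bulk, and one of
  them shares at least the average. A common point of \<open>S + t\<close> and \<open>S + t'\<close>, with \<open>t < t'\<close>, is a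
  point of \<open>S \<inter> (S + (t' - t))\<close> up to translation. This is \<open>overlap_bound\<close>.

  The hypotheses on \<open>\<theta>\<close> make \<open>n\<close> large compared with \<open>M / N\<close>, because \<open>M / N = a\<^sub>N / N = O(\<theta> N)\<close>.

  Part (1), in \<open>exists_large_overlap\<close>: take \<open>N = b\<^sub>L\<^sub>m\<close> and translate by \<open>b\<^sub>L, b\<^sub>2\<^sub>L, \<dots>, b\<^sub>L\<^sub>m\<close>. Here
  \<open>M + b\<^sub>L\<^sub>m \<le> 2 M\<close>. If no overlap reached \<open>k\<close> points, the count would keep \<open>m N / M\<close> bounded as
  \<open>m\<close> grows, whereas this quotient tends to infinity. Passing to
  every \<open>L\<close>-th element of \<open>B\<close> makes all differences at least \<open>L\<close>, which is what
  yields infinitely many elements of \<open>R\<^sub>k(A) \<inter> \<Delta>(B)\<close>.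

  Part (2), in \<open>overlap_ratio_ge\<close>: take \<open>N = n b\<^sub>n\<close> and translate by \<open>b\<^sub>1, \<dots>, b\<^sub>n\<close>. Here \<open>b\<^sub>n = N / n \<le> M / n\<close>, so
  \<open>M + b\<^sub>n\<close> is asymptotically \<open>M\<close> and the average overlap is at least \<open>(1 - o(1)) N\<^sup>2 / M\<close>, which
  is what ratio \<open>1\<close> means at the point \<open>M\<close>.
\<close>

section \<open>Overlaps of translates\<close>

lemma card_shift: "card (shift S t) = card S"
proof -
  have "shift S t = (\<lambda>a. a + t) ` S"
    by (auto simp: shift_def)
  then show ?thesis
    by (simp add: card_image inj_on_def)
qed

lemma shift_mono: "S \<subseteq> S' \<Longrightarrow> shift S x \<subseteq> shift S' x"
  by (auto simp: shift_def)

lemma Delta_mono: "T \<subseteq> B \<Longrightarrow> Delta T \<subseteq> Delta B"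
  by (auto simp: Delta_def)

lemma Delta_nonempty:
  assumes "infinite B"
  shows "Delta B \<noteq> {}"
proof -
  obtain b where b: "b \<in> B"
    using assms infinite_imp_nonempty by blast
  obtain b' where "b' \<in> B" "b' > b"
    using assms by (meson infinite_nat_iff_unbounded)
  with b show ?thesis
    by (auto simp: Delta_def)
qed

lemma shift_Int_shift_le:
  assumes "t < t'"
  shows "shift S t \<inter> shift S t' = shift (S \<inter> shift S (t' - t)) t"
proof (intro equalityI subsetI)
  fix y assume "y \<in> shift S t \<inter> shift S t'"
  then obtain a a' where y: "a \<in> S" "y = a + t" "a' \<in> S" "y = a' + t'"
    by (auto simp: shift_def)
  then have "a = a' + (t' - t)"
    using assms by simp
  with y(1,3) have "a \<in> S \<inter> shift S (t' - t)"
    unfolding shift_def by blast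
  with y(2) show "y \<in> shift (S \<inter> shift S (t' - t)) t"
    unfolding shift_def by blast
next
  fix y assume "y \<in> shift (S \<inter> shift S (t' - t)) t"
  then obtain a a' where y: "a \<in> S" "y = a + t" "a' \<in> S" "a = a' + (t' - t)"
    by (auto simp: shift_def)
  then have "y = a' + t'"
    using assms by simp
  with y show "y \<in> shift S t \<inter> shift S t'"
    unfolding shift_def by blast
qed

text \<open>With \<open>r y\<close> the number of translates through \<open>y\<close>, the sum of \<open>r\<close> counts points of translates
  and the sum of \<open>r\<^sup>2\<close> counts common points of ordered pairs of translates; Cauchy-Schwarz on
  \<open>[1, M + b]\<close> compares the two. One factor \<open>card T\<close> has been cancelled.\<close>

lemma overlap_bound:
  fixes S T :: "nat set"
  assumes S: "S \<subseteq> {1..M}" and T: "T \<subseteq> {..b}"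
    and c: "\<And>x. x \<in> Delta T \<Longrightarrow> card (S \<inter> shift S x) \<le> c"
  shows "card T * (card S)\<^sup>2 \<le> (M + b) * ((card T - 1) * c + card S)"
proof (cases "T = {}")
  case True
  then show ?thesis by simp
next
  case False
  define n where "n = card T"
  define N where "N = card S"
  have finT: "finite T" and finS: "finite S"
    using S T finite_subset by blast+
  have n: "n > 0"
    using False finT by (simp add: n_def card_gt_0_iff)
  let ?Y = "{1..M + b}"
  define r where "r y = card {t \<in> T. y \<in> shift S t}" for y
  have sub: "shift S t \<subseteq> ?Y" if "t \<in> T" for t
    using S T that by (fastforce simp: shift_def)
  have "{y \<in> ?Y. y \<in> shift S t} = shift S t" if "t \<in> T" for t
    using sub[OF that] by blast
  then have first: "(\<Sum>y\<in>?Y. r y) = N * n"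
    unfolding r_def n_def N_def
    by (intro sum_multicount) (simp_all add: finT card_shift)
  define I where "I p = card (shift S (fst p) \<inter> shift S (snd p))" for p
  have "(r y)\<^sup>2 = card {p \<in> T \<times> T. y \<in> shift S (fst p) \<and> y \<in> shift S (snd p)}" for y
  proof -
    have "{p \<in> T \<times> T. y \<in> shift S (fst p) \<and> y \<in> shift S (snd p)}
        = {t \<in> T. y \<in> shift S t} \<times> {t \<in> T. y \<in> shift S t}"
      by auto
    then show ?thesis
      by (simp add: r_def power2_eq_square card_cartesian_product)
  qed
  moreover have "(\<Sum>y\<in>?Y. card {p \<in> T \<times> T. y \<in> shift S (fst p) \<and> y \<in> shift S (snd p)})
      = (\<Sum>p\<in>T \<times> T. I p)"
  proof (rule sum_multicount_gen)
    show "\<forall>p\<in>T \<times> T. card {y \<in> ?Y. y \<in> shift S (fst p) \<and> y \<in> shift S (snd p)} = I p"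
    proof
      fix p assume "p \<in> T \<times> T"
      then have "{y \<in> ?Y. y \<in> shift S (fst p) \<and> y \<in> shift S (snd p)}
          = shift S (fst p) \<inter> shift S (snd p)"
        using sub by fastforce
      then show "card {y \<in> ?Y. y \<in> shift S (fst p) \<and> y \<in> shift S (snd p)} = I p"
        by (simp add: I_def)
    qed
  qed (simp_all add: finT)
  ultimately have second: "(\<Sum>y\<in>?Y. (r y)\<^sup>2) = (\<Sum>p\<in>T \<times> T. I p)"
    by simp
  have off: "I (t, t') \<le> c" if tt: "t \<in> T" "t' \<in> T" "t < t'" for t t'
  proof -
    have "t' - t \<in> Delta T"
      using tt by (auto simp: Delta_def)
    with c tt show ?thesis
      by (simp add: I_def shift_Int_shift_le card_shift)
  qed
  have sym: "I (t, t') = I (t', t)" for t t'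
    by (simp add: I_def Int_commute)
  have row: "(\<Sum>t'\<in>T. I (t, t')) \<le> (n - 1) * c + N" if t: "t \<in> T" for t
  proof -
    have "(\<Sum>t'\<in>T. I (t, t')) = I (t, t) + (\<Sum>t'\<in>T - {t}. I (t, t'))"
      using finT t by (rule sum.remove)
    also have "I (t, t) = N"
      by (simp add: I_def N_def card_shift)
    also have "(\<Sum>t'\<in>T - {t}. I (t, t')) \<le> (\<Sum>t'\<in>T - {t}. c)"
    proof (rule sum_mono)
      fix t' assume "t' \<in> T - {t}"
      then consider "t < t'" "t' \<in> T" | "t' < t" "t' \<in> T" by fastforce
      then show "I (t, t') \<le> c"
        using off sym t by cases metis+
    qed
    also have "(\<Sum>t'\<in>T - {t}. c) = (n - 1) * c"
      using finT t by (simp add: n_def)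
    finally show ?thesis by simp
  qed
  have "(\<Sum>p\<in>T \<times> T. I p) = (\<Sum>t\<in>T. \<Sum>t'\<in>T. I (t, t'))"
    by (simp add: sum.cartesian_product)
  also have "\<dots> \<le> (\<Sum>t\<in>T. (n - 1) * c + N)"
    by (intro sum_mono row)
  also have "\<dots> = n * ((n - 1) * c + N)"
    by (simp add: n_def)
  finally have upper: "(\<Sum>y\<in>?Y. (r y)\<^sup>2) \<le> n * ((n - 1) * c + N)"
    using second by simp
  have "real ((\<Sum>y\<in>?Y. r y)\<^sup>2) \<le> real ((\<Sum>y\<in>?Y. (r y)\<^sup>2) * (M + b))"
    using sum_squared_le_sum_of_squares[of "\<lambda>y. real (r y)" ?Y] by simp
  then have "(N * n)\<^sup>2 \<le> (\<Sum>y\<in>?Y. (r y)\<^sup>2) * (M + b)"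
    unfolding of_nat_le_iff first .
  also have "\<dots> \<le> n * ((n - 1) * c + N) * (M + b)"
    using upper by (rule mult_right_mono) simp
  finally have "n * (n * N\<^sup>2) \<le> n * ((M + b) * ((n - 1) * c + N))"
    by (simp add: power2_eq_square mult_ac)
  then show ?thesis
    using n by (simp add: n_def N_def)
qed

section \<open>Increasing enumerations and growth\<close>

lemma elt_in: "infinite A \<Longrightarrow> elt A n \<in> A"
  by (simp add: elt_def enumerate_in_set)

lemma elt_less_iff:
  assumes "infinite A" "1 \<le> m" "1 \<le> n"
  shows "elt A m < elt A n \<longleftrightarrow> m < n"
  using assms by (auto simp: elt_def)

lemma elt_le_iff:
  assumes "infinite A" "1 \<le> m" "1 \<le> n"
  shows "elt A m \<le> elt A n \<longleftrightarrow> m \<le> n"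
  using elt_less_iff[OF assms(1) assms(3) assms(2)] by (simp add: linorder_not_less[symmetric])

lemma inj_on_elt: "infinite A \<Longrightarrow> inj_on (elt A) {1..}"
  by (intro linorder_inj_onI') (metis atLeast_iff elt_less_iff less_irrefl)

lemma card_initial_segment:
  assumes "A \<subseteq> {1..}" "infinite A" "n \<ge> 1"
  shows "card (A \<inter> {1..elt A n}) = n"
proof -
  have "A \<inter> {1..elt A n} = elt A ` {1..n}"
  proof (intro equalityI subsetI)
    fix a assume a: "a \<in> A \<inter> {1..elt A n}"
    then obtain i where "enumerate A i = a"
      using enumerate_Ex[OF assms(2)] by blast
    then have i: "a = elt A (Suc i)"
      by (simp add: elt_def)
    with a have "Suc i \<le> n"
      using elt_le_iff[OF assms(2), of "Suc i" n] assms(3) by simp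
    with i show "a \<in> elt A ` {1..n}" by auto
  next
    fix a assume "a \<in> elt A ` {1..n}"
    then obtain i where "a = elt A i" "1 \<le> i" "i \<le> n" by auto
    then show "a \<in> A \<inter> {1..elt A n}"
      using assms elt_in[OF assms(2), of i] elt_le_iff[OF assms(2), of i n] by auto
  qed
  moreover have "inj_on (elt A) {1..n}"
    using inj_on_elt[OF assms(2)] by (rule inj_on_subset) auto
  ultimately show ?thesis
    by (simp add: card_image)
qed

lemma elt_ge:
  assumes "A \<subseteq> {1..}" "infinite A"
  shows "n \<le> elt A n"
proof (cases "n \<ge> 1")
  case True
  have "card (A \<inter> {1..elt A n}) \<le> card {1..elt A n}"
    by (rule card_mono) auto
  with card_initial_segment[OF assms True] show ?thesis by simp
qed simp

lemma elt_gap: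
  assumes "infinite B" "1 \<le> i"
  shows "elt B i + k \<le> elt B (i + k)"
proof (induction k)
  case (Suc k)
  have "elt B (i + k) < elt B (i + Suc k)"
    using assms by (simp add: elt_less_iff)
  with Suc show ?case by simp
qed simp

lemma growth_constant:
  fixes \<theta> :: "nat \<Rightarrow> real"
  assumes pos: "\<And>n. n \<ge> 1 \<Longrightarrow> \<theta> n > 0"
    and growth: "limsup (\<lambda>n. ereal (real (elt A n) / (real n * \<theta> n))) < \<infinity>"
  obtains C where "C > 0" "\<forall>\<^sub>F n in sequentially. real (elt A n) \<le> C * real n * \<theta> n"
proof -
  obtain C0 where "limsup (\<lambda>n. ereal (real (elt A n) / (real n * \<theta> n))) < ereal C0"
    using growth ereal_dense2 by blast
  then have "\<forall>\<^sub>F n in sequentially. real (elt A n) / (real n * \<theta> n) < C0"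
    by (drule_tac Limsup_lessD) simp
  then have "\<forall>\<^sub>F n in sequentially. real (elt A n) \<le> max C0 1 * real n * \<theta> n"
    using eventually_ge_at_top[of 1]
  proof eventually_elim
    case (elim n)
    have p: "real n * \<theta> n > 0"
      using pos[of n] elim by simp
    then have "real (elt A n) \<le> C0 * (real n * \<theta> n)"
      using elim(1) by (simp add: divide_less_eq)
    also have "\<dots> \<le> max C0 1 * (real n * \<theta> n)"
      using p by (intro mult_right_mono) auto
    finally show ?case by (simp add: mult.assoc)
  qed
  then show ?thesis
    using that[of "max C0 1"] by simp
qed

section \<open>Overlaps with many points\<close>

lemma exists_large_overlap:
  fixes A B :: "nat set" and \<theta> :: "nat \<Rightarrow> real"
  assumes A: "A \<subseteq> {1..}" "infinite A" and B: "B \<subseteq> {1..}" "infinite B"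
    and C: "C > 0" "\<forall>\<^sub>F n in sequentially. real (elt A n) \<le> C * real n * \<theta> n"
    and lim: "(\<lambda>n. \<theta> (elt B n) / real n) \<longlonglongrightarrow> 0"
    and L: "L \<ge> 1"
  obtains x where "x \<in> R k A \<inter> Delta B" "x \<ge> L"
proof -
  \<comment> \<open>With \<open>M \<le> C b (\<theta> b)\<close>, the bound \<open>\<theta> b < \<epsilon> L m\<close> gives \<open>2 M (k + 2) \<le> m b\<close>. If all overlaps had
    at most \<open>k\<close> points, the count would give \<open>m b \<le> 2 M (k + 1)\<close>.\<close>
  define \<epsilon> where "\<epsilon> = 1 / (C * real L * (2 * (real k + 2)))"
  have \<epsilon>: "\<epsilon> > 0"
    using C L by (simp add: \<epsilon>_def)
  have sub: "filterlim (\<lambda>m. L * m) sequentially sequentially"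
    using L by (intro filterlim_subseq) (simp add: strict_mono_def)
  have elt_top: "filterlim (elt B) sequentially sequentially"
    using elt_ge[OF B] by (intro filterlim_at_top_mono[OF filterlim_ident]) auto
  have "\<forall>\<^sub>F n in sequentially. \<theta> (elt B n) / real n < \<epsilon>"
    using order_tendstoD(2)[OF lim \<epsilon>] .
  then have ev1: "\<forall>\<^sub>F m in sequentially. \<theta> (elt B (L * m)) / real (L * m) < \<epsilon>"
    using sub by (rule eventually_compose_filterlim)
  have ev2: "\<forall>\<^sub>F m in sequentially.
      real (elt A (elt B (L * m))) \<le> C * real (elt B (L * m)) * \<theta> (elt B (L * m))"
    using C(2) filterlim_compose[OF elt_top sub] by (rule eventually_compose_filterlim)
  obtain m where m: "m \<ge> 1" "\<theta> (elt B (L * m)) / real (L * m) < \<epsilon>"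
    "real (elt A (elt B (L * m))) \<le> C * real (elt B (L * m)) * \<theta> (elt B (L * m))"
    using eventually_happens[OF eventually_conj[OF eventually_ge_at_top[of 1] eventually_conj[OF ev1 ev2]]]
    by auto
  define b where "b = elt B (L * m)"
  define M where "M = elt A b"
  define S where "S = A \<inter> {1..M}"
  define T where "T = (\<lambda>i. elt B (L * i)) ` {1..m}"
  have Lm: "L * m \<ge> 1" using L m by simp
  have b: "b \<ge> 1" "b \<ge> m"
  proof -
    have "1 * m \<le> L * m"
      using L by (intro mult_right_mono) auto
    then have "m \<le> L * m" by simp
    also have "\<dots> \<le> b"
      unfolding b_def by (rule elt_ge[OF B])
    finally have "m \<le> b" .
    with m show "b \<ge> 1" "b \<ge> m" by auto
  qed
  have bM: "b \<le> M"
    unfolding M_def by (rule elt_ge[OF A])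
  have cS: "card S = b"
    unfolding S_def M_def using card_initial_segment[OF A b(1)] .
  have "inj_on (\<lambda>i. elt B (L * i)) {1..m}"
  proof (rule inj_onI)
    fix i j assume ij: "i \<in> {1..m}" "j \<in> {1..m}" "elt B (L * i) = elt B (L * j)"
    moreover have "L * i \<in> {1..}" "L * j \<in> {1..}"
      using ij L by auto
    ultimately have "L * i = L * j"
      using inj_onD[OF inj_on_elt[OF B(2)]] by blast
    with L show "i = j" by simp
  qed
  then have cT: "card T = m"
    by (simp add: T_def card_image)
  have T: "T \<subseteq> {..b}" "T \<subseteq> B"
    using L Lm elt_in[OF B(2)] by (auto simp: T_def b_def elt_le_iff[OF B(2)])
  have far: "x \<ge> L" if "x \<in> Delta T" for x
  proof -
    obtain i j where ij: "i \<ge> 1" "j \<ge> 1" "elt B (L * i) < elt B (L * j)"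
      "x = elt B (L * j) - elt B (L * i)"
      using \<open>x \<in> Delta T\<close> by (auto simp: Delta_def T_def)
    have Li: "L * i \<ge> 1" "L * j \<ge> 1"
      using ij L by auto
    with ij have "L * i < L * j"
      using elt_less_iff[OF B(2) Li] by simp
    then have "i + 1 \<le> j" by simp
    then have "L * (i + 1) \<le> L * j" by (rule mult_left_mono) simp
    then have "elt B (L * i + L) \<le> elt B (L * j)"
      using elt_le_iff[OF B(2)] Li L by simp
    with elt_gap[OF B(2) Li(1), of L] ij show ?thesis by simp
  qed
  have "\<exists>x\<in>Delta T. card (S \<inter> shift S x) \<ge> k"
  proof (rule ccontr)
    assume "\<not> ?thesis"
    then have "card (S \<inter> shift S x) \<le> k" if "x \<in> Delta T" for x
      using that by fastforce
    then have "m * b\<^sup>2 \<le> (M + b) * ((m - 1) * k + b)"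
      using overlap_bound[of S M T b k] T cS cT by (simp add: S_def)
    also have "\<dots> \<le> (2 * M) * (b * (k + 1))"
    proof (rule mult_mono)
      have "(m - 1) * k \<le> b * k"
        using b by (intro mult_right_mono) auto
      then show "(m - 1) * k + b \<le> b * (k + 1)" by simp
    qed (use bM in auto)
    also have "\<dots> = b * (2 * M * (k + 1))"
      by (simp only: mult_ac)
    finally have "b * (m * b) \<le> b * (2 * M * (k + 1))"
      by (simp only: power2_eq_square mult.left_commute)
    then have "m * b \<le> 2 * M * (k + 1)"
      using b(1) mult_le_cancel1[of b "m * b" "2 * M * (k + 1)"] by linarith
    then have "real (m * b) \<le> real (2 * M * (k + 1))"
      unfolding of_nat_le_iff .
    then have low: "real m * real b \<le> 2 * real M * (real k + 1)"
      by (simp add: algebra_simps)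
    have "\<theta> b < \<epsilon> * (real L * real m)"
      using m(1,2) L by (simp add: b_def divide_less_eq)
    then have "C * real b * \<theta> b \<le> C * real b * (\<epsilon> * (real L * real m))"
      using C by (intro mult_left_mono) auto
    with m(3) have "real M \<le> C * real b * (\<epsilon> * (real L * real m))"
      by (simp add: M_def b_def)
    also have "\<dots> = real m * real b / (2 * (real k + 2))"
    proof -
      have "C * real b * (1 / (C * real L * K) * (real L * real m)) = real m * real b / K"
        if "K > 0" for K
        using C(1) L that by (simp add: field_simps)
      then show ?thesis
        unfolding \<epsilon>_def by simp
    qed
    finally have "2 * real M * (real k + 2) \<le> real m * real b"
      by (simp add: field_simps)
    with low have "real M \<le> 0" by (simp add: algebra_simps)
    with bM b show False by simp
  qed
  then obtain x where x: "x \<in> Delta T" "card (S \<inter> shift S x) \<ge> k" by blast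
  have "S \<inter> shift S x \<subseteq> A \<inter> shift A x"
    using shift_mono[of S A x] by (auto simp: S_def)
  then have "x \<in> R k A"
    using x far[OF x(1)] L card_mono[of "A \<inter> shift A x" "S \<inter> shift S x"]
    by (auto simp: R_def)
  moreover have "x \<in> Delta B"
    using x(1) Delta_mono[OF T(2)] by blast
  ultimately show thesis
    using that far[OF x(1)] by blast
qed

section \<open>Overlaps of nearly independent density\<close>

text \<open>Taking the best difference at every \<open>n\<close> defines the sequence without reference to the
  subsequence along which the ratio is controlled.\<close>

lemma exists_maximal_overlap:
  fixes A B :: "nat set"
  assumes "infinite B"
  obtains x where "x \<in> Delta B"
    "\<And>x'. x' \<in> Delta B \<Longrightarrow>
      card (A \<inter> shift A x' \<inter> {1..n}) \<le> card (A \<inter> shift A x \<inter> {1..n})"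
proof -
  let ?f = "\<lambda>x. card (A \<inter> shift A x \<inter> {1..n})"
  have bd: "?f x \<le> n" for x
    using card_mono[of "{1..n}" "A \<inter> shift A x \<inter> {1..n}"] by simp
  obtain x0 where "x0 \<in> Delta B"
    using Delta_nonempty[OF assms] by blast
  then have "arg_max ?f (\<lambda>x. x \<in> Delta B) \<in> Delta B \<and>
      (\<forall>y. y \<in> Delta B \<longrightarrow> ?f y \<le> ?f (arg_max ?f (\<lambda>x. x \<in> Delta B)))"
    using bd by (intro arg_max_nat_lemma[where b = "Suc n"]) (auto simp: less_Suc_eq_le)
  then show thesis
    using that by blast
qed

text \<open>The count at the point \<open>M = a\<^sub>N\<close> with \<open>N = n b\<^sub>n\<close>: the factor \<open>n / (n + 1)\<close> is what
  enlarging \<open>[1, M]\<close> to \<open>[1, M + b\<^sub>n]\<close> costs, and the subtracted term is the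
  diagonal contribution.\<close>

lemma overlap_ratio_ge:
  fixes A B :: "nat set" and \<theta> :: "nat \<Rightarrow> real"
  assumes A: "A \<subseteq> {1..}" "infinite A" and B: "B \<subseteq> {1..}" "infinite B"
    and n: "n \<ge> 1"
    and N_def: "N = n * elt B n" and M_def: "M = elt A N"
    and growth: "real M \<le> C * real N * \<theta> N"
    and c: "\<And>x. x \<in> Delta B \<Longrightarrow> card (A \<inter> shift A x \<inter> {1..M}) \<le> c"
  shows "real n / (real n + 1) - C * (\<theta> N / real n)
    \<le> (real c / real M) / (real (card (A \<inter> {1..M})) / real M)\<^sup>2"
proof -
  define b where "b = elt B n"
  define S where "S = A \<inter> {1..M}"
  define T where "T = elt B ` {1..n}"
  have b: "b \<ge> 1"
    using elt_ge[OF B, of n] n by (simp add: b_def)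
  have N: "N \<ge> 1" "N = n * b"
    using n b by (simp_all add: N_def b_def)
  have NM: "N \<le> M"
    unfolding M_def by (rule elt_ge[OF A])
  have cS: "card S = N"
    unfolding S_def M_def using card_initial_segment[OF A N(1)] .
  have "inj_on (elt B) {1..n}"
    using inj_on_elt[OF B(2)] by (rule inj_on_subset) auto
  then have cT: "card T = n"
    by (simp add: T_def card_image)
  have T: "T \<subseteq> {..b}" "T \<subseteq> B"
    using n elt_in[OF B(2)] by (auto simp: T_def b_def elt_le_iff[OF B(2)])
  have "card (S \<inter> shift S x) \<le> c" if "x \<in> Delta T" for x
  proof -
    have "S \<inter> shift S x \<subseteq> A \<inter> shift A x \<inter> {1..M}"
      using shift_mono[of S A x] by (auto simp: S_def)
    then have "card (S \<inter> shift S x) \<le> card (A \<inter> shift A x \<inter> {1..M})"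
      by (intro card_mono) auto
    also have "\<dots> \<le> c"
      using c that Delta_mono[OF T(2)] by blast
    finally show ?thesis .
  qed
  then have "n * N\<^sup>2 \<le> (M + b) * ((n - 1) * c + N)"
    using overlap_bound[of S M T b c] T cS cT by (simp add: S_def)
  also have "\<dots> \<le> (M + b) * (n * c + N)"
    by (intro mult_left_mono add_right_mono mult_right_mono) auto
  finally have "n * (n * N\<^sup>2) \<le> n * ((M + b) * (n * c + N))"
    by (rule mult_left_mono) simp
  also have "\<dots> = (n * M + N) * (n * c + N)"
    by (simp add: N(2) algebra_simps)
  also have "\<dots> \<le> (n * M + M) * (n * c + N)"
    using NM by (intro mult_right_mono) auto
  finally have "real (n * (n * N\<^sup>2)) \<le> real ((n * M + M) * (n * c + N))"
    unfolding of_nat_le_iff .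
  then have main: "real n * (real n * (real N)\<^sup>2)
      \<le> (real n + 1) * (real n * (real c * real M) + real M * real N)"
    by (simp add: algebra_simps)
  have "real M * real N \<le> C * real N * \<theta> N * real N"
    using growth by (rule mult_right_mono) simp
  then have "(real n + 1) * (real n * (real c * real M) + real M * real N)
      \<le> (real n + 1) * (real n * (real c * real M) + C * real N * \<theta> N * real N)"
    by (intro mult_left_mono add_left_mono) auto
  from order_trans[OF main this] have main': "real n * (real n * (real N)\<^sup>2)
      \<le> (real n + 1) * (real n * (real c * real M) + C * \<theta> N * (real N)\<^sup>2)"
    by (simp add: power2_eq_square mult_ac)
  have pos: "real n > 0" "real N > 0" "real M > 0"
    using n N(1) NM by linarith+
  have "real n / (real n + 1) - C * (\<theta> N / real n) \<le> real c * real M / (real N)\<^sup>2"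
  proof -
    have "real n / (real n + 1) = real n * (real n * (real N)\<^sup>2) / ((real n + 1) * (real n * (real N)\<^sup>2))"
      using pos by (intro nonzero_mult_divide_mult_cancel_right[symmetric]) simp
    also have "\<dots> \<le> (real n + 1) * (real n * (real c * real M) + C * \<theta> N * (real N)\<^sup>2)
        / ((real n + 1) * (real n * (real N)\<^sup>2))"
      using main' by (rule divide_right_mono) simp
    also have "\<dots> = (real n * (real c * real M) + C * \<theta> N * (real N)\<^sup>2) / (real n * (real N)\<^sup>2)"
      by (rule mult_divide_mult_cancel_left) simp
    also have "\<dots> = real c * real M / (real N)\<^sup>2 + C * (\<theta> N / real n)"
      using pos by (simp add: add_divide_distrib)
    finally show ?thesis by simp
  qed
  also have "real c * real M / (real N)\<^sup>2 = (real c / real M) / (real N / real M)\<^sup>2"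
    using pos by (simp add: power2_eq_square)
  finally show ?thesis
    using cS by (simp add: S_def)
qed

theorem mainTheorem1:
  fixes A B :: "nat set" and \<theta> :: "nat \<Rightarrow> real"
  assumes "A \<subseteq> {1..}" and "infinite A"
    and "B \<subseteq> {1..}" and "infinite B"
    and "\<And>n. n \<ge> 1 \<Longrightarrow> \<theta> n > 0"
    and "limsup (\<lambda>n. ereal (real (elt A n) / (real n * \<theta> n))) < \<infinity>"
  shows "((\<lambda>n. \<theta> (elt B n) / real n) \<longlonglongrightarrow> 0 \<longrightarrow>
            (\<forall>k\<ge>1. infinite (R k A \<inter> Delta B)))
       \<and> ((\<lambda>n. \<theta> (n * elt B n) / real n) \<longlonglongrightarrow> 0 \<longrightarrow>
            (\<exists>x :: nat \<Rightarrow> nat. (\<forall>n\<ge>1. x n \<in> Delta B) \<and>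
               limsup (\<lambda>n. ereal
                 ((real (card (A \<inter> shift A (x n) \<inter> {1..n})) / real n) /
                  (real (card (A \<inter> {1..n})) / real n)\<^sup>2)) \<ge> 1))"
proof -
  obtain C where C: "C > 0" "\<forall>\<^sub>F n in sequentially. real (elt A n) \<le> C * real n * \<theta> n"
    using growth_constant[OF assms(5,6)] by blast
  show ?thesis
  proof (intro conjI impI allI)
    fix k :: nat
    assume lim: "(\<lambda>n. \<theta> (elt B n) / real n) \<longlonglongrightarrow> 0"
    show "infinite (R k A \<inter> Delta B)"
      unfolding infinite_nat_iff_unbounded
    proof
      fix L
      obtain x where "x \<in> R k A \<inter> Delta B" "x \<ge> Suc L"
        using exists_large_overlap[OF assms(1-4) C lim, of "Suc L" k] by auto
      then show "\<exists>x>L. x \<in> R k A \<inter> Delta B"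
        by (meson Suc_le_lessD)
    qed
  next
    assume lim: "(\<lambda>n. \<theta> (n * elt B n) / real n) \<longlonglongrightarrow> 0"
    have "\<exists>x. x \<in> Delta B \<and> (\<forall>x'\<in>Delta B.
        card (A \<inter> shift A x' \<inter> {1..n}) \<le> card (A \<inter> shift A x \<inter> {1..n}))" for n
      using exists_maximal_overlap[OF assms(4), of A n] by metis
    then obtain x where x: "x n \<in> Delta B"
      and max: "\<And>x'. x' \<in> Delta B \<Longrightarrow>
        card (A \<inter> shift A x' \<inter> {1..n}) \<le> card (A \<inter> shift A (x n) \<inter> {1..n})" for n
      by metis
    define q where "q n = (real (card (A \<inter> shift A (x n) \<inter> {1..n})) / real n) /
                  (real (card (A \<inter> {1..n})) / real n)\<^sup>2" for n
    define N where "N n = n * elt B n" for n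
    have N_ge: "N n \<ge> n" for n
      using elt_ge[OF assms(3,4), of n] by (cases n) (auto simp: N_def)
    \<comment> \<open>Index \<open>0\<close> is skipped: strict growth of the enumeration starts at \<open>1\<close>.\<close>
    define g where "g n = elt A (N (Suc n))" for n
    have "g n < g (Suc n)" for n
    proof -
      have "elt B (Suc n) < elt B (Suc (Suc n))"
        using assms(4) by (simp add: elt_less_iff)
      then have "N (Suc n) < N (Suc (Suc n))"
        unfolding N_def by (intro mult_strict_mono) auto
      moreover have "1 \<le> N (Suc n)" "1 \<le> N (Suc (Suc n))"
        using N_ge[of "Suc n"] N_ge[of "Suc (Suc n)"] by auto
      ultimately show ?thesis
        using assms(2) by (simp add: g_def elt_less_iff)
    qed
    then have g: "strict_mono g"
      by (simp add: strict_mono_Suc_iff)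
    define l where "l n = real n / (real n + 1) - C * (\<theta> (N n) / real n)" for n
    have "(\<lambda>n. real n / (real n + 1)) \<longlonglongrightarrow> 1"
      using LIMSEQ_n_over_Suc_n by (simp add: add.commute)
    moreover have "(\<lambda>n. C * (\<theta> (N n) / real n)) \<longlonglongrightarrow> C * 0"
      unfolding N_def by (intro tendsto_mult tendsto_const lim)
    ultimately have "l \<longlonglongrightarrow> 1 - C * 0"
      unfolding l_def by (rule tendsto_diff)
    then have l: "(\<lambda>n. ereal (l (Suc n))) \<longlonglongrightarrow> 1"
      using LIMSEQ_Suc by (fastforce simp: one_ereal_def)
    have "filterlim (\<lambda>n. N (Suc n)) sequentially sequentially"
      using Suc_leD[OF N_ge]
      by (intro filterlim_at_top_mono[OF filterlim_ident]) (simp add: always_eventually)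
    with C(2) have "\<forall>\<^sub>F n in sequentially. real (g n) \<le> C * real (N (Suc n)) * \<theta> (N (Suc n))"
      unfolding g_def by (rule eventually_compose_filterlim)
    then have "\<forall>\<^sub>F n in sequentially. ereal (l (Suc n)) \<le> ((\<lambda>n. ereal (q n)) \<circ> g) n"
    proof eventually_elim
      case (elim n)
      have "l (Suc n) \<le> q (g n)"
        unfolding l_def q_def
        using assms(1-4) N_def[of "Suc n"] g_def[of n] elim max
        by (intro overlap_ratio_ge[where \<theta> = \<theta> and B = B]) auto
      then show ?case by simp
    qed
    then have "limsup (\<lambda>n. ereal (l (Suc n))) \<le> limsup ((\<lambda>n. ereal (q n)) \<circ> g)"
      by (rule Limsup_mono)
    also have "\<dots> \<le> limsup (\<lambda>n. ereal (q n))"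
      using g by (rule limsup_subseq_mono)
    finally have "1 \<le> limsup (\<lambda>n. ereal (q n))"
      using lim_imp_Limsup[OF _ l] by simp
    then show "\<exists>x :: nat \<Rightarrow> nat. (\<forall>n\<ge>1. x n \<in> Delta B) \<and>
               limsup (\<lambda>n. ereal
                 ((real (card (A \<inter> shift A (x n) \<inter> {1..n})) / real n) /
                  (real (card (A \<inter> {1..n})) / real n)\<^sup>2)) \<ge> 1"
      using x unfolding q_def by blast
  qed
qed

end
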